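(* Let $n\ge 1$, let $\alpha\in\mathbb{Z}_{\ge1}^n$ with $d:=\sum_{j=1}^n\alpha_j\ge 2$, let $S\subseteq[0,1]^n$ be a nonempty compact convex set, and let $f(x)=x^\alpha=\prod_{j=1}^n x_j^{\alpha_j}$. Then $$\mu\big(\mathcal{G}(\operatorname{vex}_S[f])\big)\le\Big(1-\frac1{|\gamma|}\Big)^{|\gamma|}\le \mathscr{C}^2_d,\qquad \mu\big(\mathcal{G}(\operatorname{cav}_S[f])\big)\le\mu\big(\operatorname{conv}\mathcal{G}_S(f)\big)\le\mathscr{C}^1_d,$$ where, for $\sigma_j:=1-\max\{x_j\mid x\in S\}$, $$\gamma_j:=\begin{cases}\dfrac{1-(1-\sigma_j)^{\alpha_j}}{\sigma_j},&\sigma_j>0,\\[2mm] \alpha_j,&\sigma_j=0,\end{cases}\qquad j=1,\dots,n,\qquad |\gamma|:=\sum_{j=1}^n\gamma_j .$$ Moreover, if $\mathbf 0,\mathbf 1\in S$, then $\mu(\operatorname{conv}\mathcal{G}_S(f))=\mu(\mathcal{G}(\operatorname{cav}_S[f]))=\mathscr{C}^1_d$.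
   Context: $\mathbf 0,\mathbf 1\in\mathbb{R}^n$ are the all-zeros and all-ones vectors. For a set $X$ in $(x,w)$-space $\mathbb{R}^n\times\mathbb{R}$, the error with respect to the monomial is $\mu(X):=\max_{(x,w)\in X}|w-x^\alpha|$. The graph of a function $g$ on $S$ is $\mathcal{G}_S(g)=\{(x,w)\in S\times\mathbb{R}\mid w=g(x)\}$. $\operatorname{vex}_S[f]$ is the convex envelope of $f$ over $S$ (the pointwise supremum of all convex underestimators of $f$ on $S$), $\operatorname{cav}_S[f]$ is the concave envelope (the pointwise infimum of all concave overestimators of $f$ on $S$), and $\mathcal{G}(\operatorname{vex}_S[f])$, $\mathcal{G}(\operatorname{cav}_S[f])$ denote their graphs over $S$. The constants are $$\mathscr{C}^1_d:=\Big(1-\frac1d\Big)d^{\frac1{1-d}},\qquad \mathscr{C}^2_d:=\Big(1-\frac1d\Big)^d .$$ *)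

theory Defs
  imports "HOL-Analysis.Analysis"
begin

definition monomial :: "(nat ^ 'n) \<Rightarrow> (real ^ 'n) \<Rightarrow> real" where
  "monomial \<alpha> x = (\<Prod>j\<in>UNIV. x $ j ^ (\<alpha> $ j))"

definition total_degree :: "(nat ^ 'n) \<Rightarrow> nat" where
  "total_degree \<alpha> = (\<Sum>j\<in>UNIV. \<alpha> $ j)"

text \<open>The attained maximum of a set of reals, as opposed to its supremum; unspecified
  if the set has no greatest element.\<close>

definition maximum :: "real set \<Rightarrow> real" where
  "maximum A = (GREATEST a. a \<in> A)"

definition monomial_error :: "(nat ^ 'n) \<Rightarrow> ((real ^ 'n) \<times> real) set \<Rightarrow> real" where
  "monomial_error \<alpha> X = maximum {\<bar>w - monomial \<alpha> x\<bar> | x w. (x, w) \<in> X}"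

definition graph_on :: "'a set \<Rightarrow> ('a \<Rightarrow> real) \<Rightarrow> ('a \<times> real) set" where
  "graph_on S g = {(x, w). x \<in> S \<and> w = g x}"

text \<open>The envelopes are meaningful at points of \<open>S\<close> only, and for functions that have at least
  one convex underestimator (respectively concave overestimator) on \<open>S\<close>; at such points the
  supremum (infimum) is that of a nonempty set bounded by \<open>f x\<close>.\<close>

definition vex :: "'a::real_vector set \<Rightarrow> ('a \<Rightarrow> real) \<Rightarrow> 'a \<Rightarrow> real" where
  "vex S f x = (SUP g \<in> {g. convex_on S g \<and> (\<forall>y\<in>S. g y \<le> f y)}. g x)"

definition cav :: "'a::real_vector set \<Rightarrow> ('a \<Rightarrow> real) \<Rightarrow> 'a \<Rightarrow> real" where
  "cav S f x = (INF g \<in> {g. concave_on S g \<and> (\<forall>y\<in>S. f y \<le> g y)}. g x)"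

definition sigma_coord :: "(real ^ 'n) set \<Rightarrow> 'n \<Rightarrow> real" where
  "sigma_coord S j = 1 - maximum {x $ j | x. x \<in> S}"

text \<open>For \<open>S\<close> contained in the unit cube, \<open>sigma_coord S j \<ge> 0\<close>, so the second branch is the
  case \<open>sigma_coord S j = 0\<close>.\<close>

definition gamma_coord :: "(real ^ 'n) set \<Rightarrow> (nat ^ 'n) \<Rightarrow> 'n \<Rightarrow> real" where
  "gamma_coord S \<alpha> j =
     (if sigma_coord S j > 0 then (1 - (1 - sigma_coord S j) ^ (\<alpha> $ j)) / sigma_coord S j else real (\<alpha> $ j))"

definition gamma_sum :: "(real ^ 'n) set \<Rightarrow> (nat ^ 'n) \<Rightarrow> real" where
  "gamma_sum S \<alpha> = (\<Sum>j\<in>UNIV. gamma_coord S \<alpha> j)"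

definition C1 :: "nat \<Rightarrow> real" where
  "C1 d = (1 - 1 / real d) * real d powr (1 / (1 - real d))"

definition C2 :: "nat \<Rightarrow> real" where
  "C2 d = (1 - 1 / real d) ^ d"

end

theory Submission
  imports Defs
begin

text \<open>Write \<open>H\<close> for the convex hull of the graph of \<open>f\<close>. It is compact and its lower and upper
  boundaries are the graphs of \<open>vex\<close> and \<open>cav\<close>, so all errors are maxima over \<open>H\<close>, and an affine
  inequality valid on the graph of \<open>f\<close> passes to \<open>H\<close>.

  Below, factorwise secants and the product inequality \<open>\<Prod>(1 - t j) \<ge> 1 - \<Sum>t j\<close> show that points of \<open>H\<close>
  satisfy \<open>w \<ge> max 0 (1 - \<Gamma> * y)\<close> with \<open>\<Gamma> = \<bar>\<gamma>\<bar>\<close> and \<open>\<Gamma> * y = \<Sum>\<gamma> j * (1 - x j)\<close>, whereas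
  \<open>f x \<le> (1 - y) powr \<Gamma>\<close> by the weighted AM-GM inequality; the difference is largest at \<open>y = 1 / \<Gamma>\<close>.

  Above, \<open>w \<le> m\<close> and \<open>f x \<ge> m ^ d\<close> for the least coordinate \<open>m\<close> of \<open>x\<close>, and \<open>m - m ^ d\<close> is largest at
  \<open>m = d powr (1 / (1 - d))\<close>. If \<open>0\<close> and \<open>1\<close> lie in \<open>S\<close>, this value is attained on the diagonal.\<close>

subsection \<open>Real inequalities\<close>

text \<open>Apply \<open>ln u \<le> u - 1\<close> at \<open>u = x i / m\<close>, where
  \<open>m\<close> is the weighted mean: the weighted corrections then sum to 0.\<close>

lemma weighted_arith_geom_mean:
  fixes x w :: "'a \<Rightarrow> real"
  assumes "finite I" and x: "\<And>i. i \<in> I \<Longrightarrow> x i \<ge> 0" and w: "\<And>i. i \<in> I \<Longrightarrow> w i \<ge> 0"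
    and W: "sum w I > 0"
  shows "(\<Prod>i\<in>I. x i powr w i) \<le> ((\<Sum>i\<in>I. w i * x i) / sum w I) powr sum w I"
proof (cases "\<exists>i\<in>I. x i = 0")
  case True
  \<comment> \<open>\<open>0 powr a\<close> is 0 for every \<open>a\<close>, even for
    \<open>a = 0\<close>, so a zero entry annihilates the product whatever its weight.\<close>
  then have "(\<Prod>i\<in>I. x i powr w i) = 0"
    using \<open>finite I\<close> by auto
  then show ?thesis by simp
next
  case False
  then have xpos: "x i > 0" if "i \<in> I" for i
    using x that by (metis order_le_less)
  define m where "m = (\<Sum>i\<in>I. w i * x i) / sum w I"
  obtain k where "k \<in> I" "w k > 0"
    using W w by (metis less_le sum_nonpos not_less)
  then have "(\<Sum>i\<in>I. w i * x i) > 0"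
    using sum_pos2[OF \<open>finite I\<close> \<open>k \<in> I\<close>, of "\<lambda>i. w i * x i"] xpos w
    by (simp add: less_imp_le)
  then have m: "m > 0"
    using W by (simp add: m_def)
  have "x i powr w i \<le> m powr w i * exp (w i * (x i / m - 1))" if "i \<in> I" for i
  proof -
    have "ln (x i) \<le> ln m + (x i / m - 1)"
      using ln_le_minus_one[of "x i / m"] m xpos[OF that] by (simp add: ln_div)
    then have "w i * ln (x i) \<le> w i * (ln m + (x i / m - 1))"
      using w[OF that] by (rule mult_left_mono)
    then show ?thesis
      using m xpos[OF that] by (simp add: powr_def mult_exp_exp algebra_simps)
  qed
  then have "(\<Prod>i\<in>I. x i powr w i) \<le> (\<Prod>i\<in>I. m powr w i * exp (w i * (x i / m - 1)))"
    by (intro prod_mono) simp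
  also have "\<dots> = m powr sum w I * exp (\<Sum>i\<in>I. w i * (x i / m - 1))"
    using m \<open>finite I\<close> by (simp add: prod.distrib exp_sum powr_sum)
  also have "(\<Sum>i\<in>I. w i * (x i / m - 1)) = (\<Sum>i\<in>I. w i * x i) / m - sum w I"
    by (simp add: right_diff_distrib sum_subtractf sum_divide_distrib)
  also have "\<dots> = 0"
    using \<open>(\<Sum>i\<in>I. w i * x i) > 0\<close> W by (simp add: m_def)
  finally show ?thesis
    by (simp add: m_def)
qed

text \<open>Weighted AM-GM for the two numbers \<open>1 - 1 / a\<close> and \<open>1\<close> with
  weights \<open>a\<close> and \<open>b - a\<close>, whose mean is \<open>1 - 1 / b\<close>.\<close>

lemma one_minus_inverse_powr_mono:
  fixes a b :: real
  assumes "1 \<le> a" "a \<le> b"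
  shows "(1 - 1 / a) powr a \<le> (1 - 1 / b) powr b"
proof -
  define x w where "x = (\<lambda>i. if i then 1 - 1 / a else 1)" and "w = (\<lambda>i. if i then a else b - a)"
  have "(\<Prod>i\<in>UNIV. x i powr w i) \<le> ((\<Sum>i\<in>UNIV. w i * x i) / sum w UNIV) powr sum w UNIV"
    using assms by (intro weighted_arith_geom_mean) (auto simp: x_def w_def UNIV_bool)
  moreover have "(a * (1 - 1 / a) + (b - a)) / b = 1 - 1 / b"
    using assms by (simp add: field_simps)
  ultimately show ?thesis
    by (simp add: x_def w_def UNIV_bool add.commute)
qed

text \<open>On the unit interval the derivative of \<open>t powr p\<close> is at most
  \<open>p\<close>, so \<open>p * t - t powr p\<close> is nondecreasing.\<close>

lemma powr_diff_le:
  fixes a b p :: real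
  assumes "0 \<le> b" "b \<le> a" "a \<le> 1" "1 \<le> p"
  shows "a powr p - b powr p \<le> p * (a - b)"
proof (cases "a = b")
  case False
  have "p * b - b powr p \<le> p * a - a powr p"
  proof (rule DERIV_nonneg_imp_increasing_open[where f = "\<lambda>t. p * t - t powr p"])
    fix t assume t: "b < t" "t < a"
    have "((\<lambda>t. p * t - t powr p) has_real_derivative p - p * t powr (p - 1)) (at t)"
      using t assms by (auto intro!: derivative_eq_intros)
    moreover have "t powr (p - 1) \<le> 1"
      using t assms by (intro powr_le1) auto
    then have "0 \<le> p - p * t powr (p - 1)"
      using assms mult_left_mono[of "t powr (p - 1)" 1 p] by simp
    ultimately show "\<exists>y. ((\<lambda>t. p * t - t powr p) has_real_derivative y) (at t) \<and> 0 \<le> y"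
      by blast
  next
    show "continuous_on {b..a} (\<lambda>t. p * t - t powr p)"
      using assms by (intro continuous_intros continuous_on_powr') auto
  qed (use assms in auto)
  then show ?thesis
    by (simp add: algebra_simps)
qed auto

text \<open>The maximum switches branch at \<open>y = 1 / p\<close>. Before that point the power
  exceeds its value there by at most \<open>1 - p * y\<close>, by the slope bound; beyond it the
  affine term is negative and the power decreases.\<close>

lemma powr_minus_max_affine_le:
  fixes y p :: real
  assumes "0 \<le> y" "y \<le> 1" "1 \<le> p"
  shows "(1 - y) powr p - max 0 (1 - p * y) \<le> (1 - 1 / p) powr p"
proof (cases "y \<le> 1 / p")
  case True
  have "(1 - y) powr p - (1 - 1 / p) powr p \<le> p * ((1 - y) - (1 - 1 / p))"
    using assms True by (intro powr_diff_le) auto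
  also have "\<dots> = 1 - p * y"
    using assms by (simp add: field_simps)
  finally show ?thesis
    by linarith
next
  case False
  then have "(1 - y) powr p \<le> (1 - 1 / p) powr p"
    using assms by (intro powr_mono2) auto
  then show ?thesis
    by linarith
qed

text \<open>Weierstrass product inequality; the induction step expands
  \<open>(1 - u k) * (1 - prod u I) \<ge> 0\<close>.\<close>

lemma one_minus_sum_le_prod:
  fixes u :: "'a \<Rightarrow> real"
  assumes "finite I" "\<And>i. i \<in> I \<Longrightarrow> 0 \<le> u i \<and> u i \<le> 1"
  shows "1 - (\<Sum>i\<in>I. 1 - u i) \<le> prod u I"
  using assms
proof (induction I rule: finite_induct)
  case (insert k I)
  have "prod u I \<le> 1"
    using insert.prems by (intro prod_le_1) auto
  then have "0 \<le> (1 - u k) * (1 - prod u I)"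
    using insert.prems by simp
  moreover have "1 - (\<Sum>i\<in>I. 1 - u i) \<le> prod u I"
    using insert by auto
  ultimately show ?case
    using insert.hyps by (simp add: algebra_simps)
qed simp

text \<open>\<open>c\<close> is the stationary point of \<open>t - t ^ d\<close>: the third claim is
  \<open>d * c ^ (d - 1) = 1\<close> multiplied by \<open>c\<close>.\<close>

lemma C1_argmax:
  fixes d :: nat
  assumes "d \<ge> 2"
  defines "c \<equiv> real d powr (1 / (1 - real d))"
  shows "0 < c" and "c \<le> 1" and "real d * c ^ d = c" and "c - c ^ d = C1 d"
proof -
  show "0 < c"
    using assms by simp
  have "real d powr (1 / (1 - real d)) \<le> real d powr 0"
    using assms by (intro powr_mono) auto
  then show "c \<le> 1"
    using assms by simp
  have "c ^ d = real d powr (real d / (1 - real d))"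
    using assms by (simp add: powr_powr flip: powr_realpow)
  moreover have "real d * real d powr (real d / (1 - real d)) = real d powr (1 + real d / (1 - real d))"
    using assms by (simp add: powr_add)
  moreover have "1 + real d / (1 - real d) = 1 / (1 - real d)"
    using assms by (simp add: field_simps)
  ultimately show cd: "real d * c ^ d = c"
    by (simp add: c_def)
  have "c ^ d = c / real d"
    using cd assms by (simp add: field_simps)
  then show "c - c ^ d = C1 d"
    by (simp add: C1_def c_def algebra_simps)
qed

text \<open>\<open>t ^ d\<close> lies above its tangent at \<open>c\<close>, which has slope 1.
  Bernoulli's inequality for \<open>t / c\<close> is this tangent bound after scaling.\<close>

lemma minus_power_le_C1:
  fixes t :: real
  assumes "d \<ge> 2" "0 \<le> t"
  shows "t - t ^ d \<le> C1 d"
proof -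
  define c where "c = real d powr (1 / (1 - real d))"
  note c = C1_argmax[OF \<open>d \<ge> 2\<close>, folded c_def]
  have "1 + real d * (t / c - 1) \<le> (1 + (t / c - 1)) ^ d"
    using assms c(1) by (intro Bernoulli_inequality) simp
  then have "(1 + real d * (t / c - 1)) * c ^ d \<le> (t / c) ^ d * c ^ d"
    using c(1) by (intro mult_right_mono) auto
  also have "(t / c) ^ d * c ^ d = t ^ d"
    using c(1) by (simp add: power_divide)
  also have "(1 + real d * (t / c - 1)) * c ^ d = c ^ d + (real d * c ^ d) * (t / c - 1)"
    by (simp add: algebra_simps)
  also have "\<dots> = c ^ d + t - c"
    unfolding c(3) using c(1) by (simp add: field_simps)
  finally show ?thesis
    using c(4) by simp
qed

text \<open>Lets the bound for the hull cover the gap below the monomial too. With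
  \<open>m = d - 1\<close> and a common factor \<open>1 - 1 / d\<close> removed, it remains to see
  \<open>d \<le> (1 + 1 / m) ^ (m * m)\<close>, which is Bernoulli's inequality.\<close>

lemma C2_le_C1:
  assumes "d \<ge> 2"
  shows "C2 d \<le> C1 d"
proof -
  define m where "m = d - 1"
  have d: "d = Suc m" "m \<ge> 1" "real d = 1 + real m"
    using assms by (auto simp: m_def)
  define b where "b = 1 + 1 / real m"
  have b: "b > 0" "1 - 1 / real d = 1 / b"
    using d by (auto simp: b_def field_simps add_pos_nonneg)
  have "1 + real (m * m) * (1 / real m) \<le> b ^ (m * m)"
    unfolding b_def by (intro Bernoulli_inequality) (simp add: order_trans[of _ 0])
  then have "real d \<le> (b ^ m) powr real m"
    using d b by (simp add: power_mult powr_realpow)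
  then have "real d powr (1 / real m) \<le> ((b ^ m) powr real m) powr (1 / real m)"
    by (intro powr_mono2) auto
  then have "real d powr (1 / real m) \<le> b ^ m"
    using d b by (simp add: powr_powr)
  then have "1 / b ^ m \<le> 1 / real d powr (1 / real m)"
    using d b by (intro divide_left_mono mult_pos_pos) auto
  also have "\<dots> = real d powr (- (1 / real m))"
    by (simp only: powr_minus_divide)
  also have "- (1 / real m) = 1 / (1 - real d)"
    using d by simp
  finally have "1 / b * (1 / b ^ m) \<le> 1 / b * real d powr (1 / (1 - real d))"
    using b by (intro mult_left_mono) auto
  then show ?thesis
    unfolding C1_def C2_def b(2) by (simp add: d(1) power_divide)
qed

subsection \<open>Envelopes and the convex hull of the graph\<close>

lemma maximum_eqI:
  assumes "m \<in> A" "\<And>a. a \<in> A \<Longrightarrow> a \<le> m"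
  shows "maximum A = m"
  unfolding maximum_def by (rule Greatest_equality) (use assms in auto)

lemma compact_convex_hull_graph:
  fixes f :: "'a::euclidean_space \<Rightarrow> real"
  assumes "compact S" "continuous_on S f"
  shows "compact (convex hull (graph_on S f))"
proof -
  have "graph_on S f = (\<lambda>x. (x, f x)) ` S"
    by (auto simp: graph_on_def)
  then show ?thesis
    using assms by (simp add: compact_convex_hull compact_continuous_image continuous_on_Pair continuous_on_id)
qed

text \<open>The epigraph of \<open>g\<close> over \<open>S\<close> is convex and contains the graph
  of \<open>f\<close>, hence also its hull.\<close>

lemma convex_hull_graph_above:
  assumes "convex_on S g" "\<And>y. y \<in> S \<Longrightarrow> g y \<le> f y" "(x, w) \<in> convex hull (graph_on S f)"
  shows "x \<in> S" "g x \<le> w"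
proof -
  have "convex hull (graph_on S f) \<subseteq> epigraph S g"
    using assms(1,2) by (intro hull_minimal convex_epigraphI) (auto simp: graph_on_def epigraph_def)
  then show "x \<in> S" "g x \<le> w"
    using assms(3) by (auto simp: epigraph_def)
qed

text \<open>The reflection of \<open>(y, v)\<close> to \<open>(y, - v)\<close> is linear, so it
  commutes with hulls and reduces this to the convex case.\<close>

lemma convex_hull_graph_below:
  assumes "concave_on S g" "\<And>y. y \<in> S \<Longrightarrow> f y \<le> g y" "(x, w) \<in> convex hull (graph_on S f)"
  shows "w \<le> g x"
proof -
  have "linear (\<lambda>(y, v). (y, - v) :: 'a \<times> real)"
    by (auto intro!: linearI)
  from convex_hull_linear_image[OF this, of "graph_on S f"]
  have "(x, - w) \<in> convex hull ((\<lambda>(y, v). (y, - v)) ` graph_on S f)"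
    using assms(3) by (auto simp: image_iff intro!: bexI[of _ "(x, w)"])
  also have "(\<lambda>(y, v). (y, - v)) ` graph_on S f = graph_on S (\<lambda>y. - f y)"
    by (auto simp: graph_on_def)
  finally have "- g x \<le> - w"
    using assms(1,2) convex_hull_graph_above(2)[of S "\<lambda>y. - g y" "\<lambda>y. - f y" x "- w"]
    by (simp add: concave_on_def)
  then show ?thesis by simp
qed

text \<open>The lower boundary \<open>v\<close> of the hull is convex because the hull is, lies
  below \<open>f\<close>, and dominates every convex underestimator because the hull does. So the
  supremum defining \<open>vex\<close> is attained by \<open>v\<close>.\<close>

lemma vex_lower_boundary:
  fixes f :: "'a::euclidean_space \<Rightarrow> real"
  assumes S: "compact S" "convex S" and f: "continuous_on S f" and "x \<in> S"
  shows "(x, vex S f x) \<in> convex hull (graph_on S f)"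
    and "(x, w) \<in> convex hull (graph_on S f) \<Longrightarrow> vex S f x \<le> w"
proof -
  define H where "H = convex hull (graph_on S f)"
  have H: "compact H" "convex H"
    unfolding H_def by (simp_all add: compact_convex_hull_graph S f)
  have graph: "(y, f y) \<in> H" if "y \<in> S" for y
    unfolding H_def by (rule hull_inc) (use that in \<open>auto simp: graph_on_def\<close>)
  have "\<exists>v. (y, v) \<in> H \<and> (\<forall>w. (y, w) \<in> H \<longrightarrow> v \<le> w)" if "y \<in> S" for y
  proof -
    \<comment> \<open>The vertical fibre of the hull over \<open>y\<close> is compact, so it has a
      lowest point.\<close>
    define F where "F = H \<inter> ({y} \<times> UNIV)"
    have "compact F"
      unfolding F_def by (intro compact_Int_closed H closed_Times) auto
    moreover have "F \<noteq> {}"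
      using graph[OF that] by (auto simp: F_def)
    moreover have "continuous_on F snd"
      by (intro continuous_intros)
    ultimately have "\<exists>p\<in>F. \<forall>q\<in>F. snd p \<le> snd q"
      by (rule continuous_attains_inf)
    then obtain p where "p \<in> F" "\<And>q. q \<in> F \<Longrightarrow> snd p \<le> snd q"
      by blast
    then show ?thesis
      by (intro exI[of _ "snd p"]) (force simp: F_def)
  qed
  then obtain v where v: "\<And>y. y \<in> S \<Longrightarrow> (y, v y) \<in> H"
      "\<And>y w. y \<in> S \<Longrightarrow> (y, w) \<in> H \<Longrightarrow> v y \<le> w"
    by metis
  have "convex_on S v"
    unfolding convex_on_def
  proof (intro conjI ballI allI impI)
    fix y z and s t :: real
    assume *: "y \<in> S" "z \<in> S" "0 \<le> s" "0 \<le> t" "s + t = 1"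
    then have "s *\<^sub>R (y, v y) + t *\<^sub>R (z, v z) \<in> H"
      by (intro convexD[OF H(2)] v)
    moreover have "s *\<^sub>R y + t *\<^sub>R z \<in> S"
      using * by (intro convexD[OF S(2)])
    ultimately show "v (s *\<^sub>R y + t *\<^sub>R z) \<le> s * v y + t * v z"
      using v(2) by simp
  qed (rule S)
  moreover have "v y \<le> f y" if "y \<in> S" for y
    using v(2) graph that by blast
  moreover have "g x \<le> v x" if "convex_on S g" "\<forall>y\<in>S. g y \<le> f y" for g
    using convex_hull_graph_above(2)[of S g f x "v x"] that v(1)[OF \<open>x \<in> S\<close>] by (auto simp: H_def)
  ultimately have "vex S f x = v x"
    unfolding vex_def by (intro cSup_eq_maximum) auto
  then show "(x, vex S f x) \<in> convex hull (graph_on S f)"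
    and "(x, w) \<in> convex hull (graph_on S f) \<Longrightarrow> vex S f x \<le> w"
    using v \<open>x \<in> S\<close> by (auto simp: H_def)
qed

text \<open>Negation exchanges the two families of functions, and \<open>Inf\<close> on the reals is
  by definition the negated \<open>Sup\<close> of the negated set.\<close>

lemma cav_eq_uminus_vex: "cav S f x = - vex S (\<lambda>y. - f y) x"
proof -
  have "uminus ` (\<lambda>g. g x) ` {g. concave_on S g \<and> (\<forall>y\<in>S. f y \<le> g y)}
    = (\<lambda>g. g x) ` {g. convex_on S g \<and> (\<forall>y\<in>S. g y \<le> - f y)}" (is "?L = ?R")
  proof (intro equalityI subsetI)
    fix r assume "r \<in> ?L"
    then obtain g where "concave_on S g" "\<forall>y\<in>S. f y \<le> g y" "r = - g x"
      by auto
    then show "r \<in> ?R"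
      by (intro image_eqI[of _ _ "\<lambda>y. - g y"]) (auto simp: concave_on_def)
  next
    fix r assume "r \<in> ?R"
    then obtain g where "convex_on S g" "\<forall>y\<in>S. g y \<le> - f y" "r = g x"
      by auto
    then have "- r \<in> (\<lambda>g. g x) ` {g. concave_on S g \<and> (\<forall>y\<in>S. f y \<le> g y)}"
      by (intro image_eqI[of _ _ "\<lambda>y. - g y"]) (force simp: concave_on_def)+
    then show "r \<in> ?L"
      by (rule image_eqI[rotated]) simp
  qed
  then show ?thesis
    unfolding cav_def vex_def Inf_real_def by simp
qed

lemma cav_upper_boundary:
  fixes f :: "'a::euclidean_space \<Rightarrow> real"
  assumes S: "compact S" "convex S" and f: "continuous_on S f" and "x \<in> S"
  shows "(x, cav S f x) \<in> convex hull (graph_on S f)"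
    and "(x, w) \<in> convex hull (graph_on S f) \<Longrightarrow> w \<le> cav S f x"
proof -
  have "linear (\<lambda>(y, v). (y, - v) :: 'a \<times> real)"
    by (auto intro!: linearI)
  moreover have "(\<lambda>(y, v). (y, - v)) ` graph_on S f = graph_on S (\<lambda>y. - f y)"
    by (auto simp: graph_on_def)
  ultimately have reflect: "convex hull (graph_on S (\<lambda>y. - f y))
      = (\<lambda>(y, v). (y, - v)) ` (convex hull (graph_on S f))"
    by (metis convex_hull_linear_image)
  note vex = vex_lower_boundary[OF S continuous_on_minus[OF f] \<open>x \<in> S\<close>, unfolded reflect]
  show "(x, cav S f x) \<in> convex hull (graph_on S f)"
    using vex(1) by (auto simp: cav_eq_uminus_vex)
  show "w \<le> cav S f x" if "(x, w) \<in> convex hull (graph_on S f)"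
    using vex(2)[of "- w"] that by (force simp: cav_eq_uminus_vex)
qed

subsection \<open>Attainment of the errors\<close>

lemma continuous_on_monomial: "continuous_on A (monomial \<alpha>)"
  unfolding monomial_def by (intro continuous_intros)

lemma monomial_error_eqI:
  assumes "(x, w) \<in> X" "\<And>y v. (y, v) \<in> X \<Longrightarrow> \<bar>v - monomial \<alpha> y\<bar> \<le> \<bar>w - monomial \<alpha> x\<bar>"
  shows "monomial_error \<alpha> X = \<bar>w - monomial \<alpha> x\<bar>"
  unfolding monomial_error_def by (rule maximum_eqI) (use assms in auto)

text \<open>\<open>maximum\<close> is informative only if a greatest element exists; compactness and
  continuity supply one.\<close>

lemma monomial_error_attained:
  assumes "compact X" "X \<noteq> {}"
  obtains x w where "(x, w) \<in> X" "monomial_error \<alpha> X = \<bar>w - monomial \<alpha> x\<bar>"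
    "\<And>y v. (y, v) \<in> X \<Longrightarrow> \<bar>v - monomial \<alpha> y\<bar> \<le> monomial_error \<alpha> X"
proof -
  have "continuous_on X (\<lambda>p. \<bar>snd p - monomial \<alpha> (fst p)\<bar>)"
    unfolding monomial_def by (intro continuous_intros)
  from continuous_attains_sup[OF assms this]
  obtain p where p: "p \<in> X"
      "\<And>q. q \<in> X \<Longrightarrow> \<bar>snd q - monomial \<alpha> (fst q)\<bar> \<le> \<bar>snd p - monomial \<alpha> (fst p)\<bar>"
    by blast
  have max: "\<bar>v - monomial \<alpha> y\<bar> \<le> \<bar>snd p - monomial \<alpha> (fst p)\<bar>" if "(y, v) \<in> X" for y v
    using p(2)[OF that] by simp
  have "monomial_error \<alpha> X = \<bar>snd p - monomial \<alpha> (fst p)\<bar>"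
    by (rule monomial_error_eqI) (use p(1) max in auto)
  with p(1) max show thesis
    by (intro that[of "fst p" "snd p"]) auto
qed

text \<open>A convex envelope need not be continuous on \<open>S\<close>; the maximum over \<open>S\<close> exists because it is
  also the maximum of a continuous function over the compact hull.\<close>

lemma vex_gap_attained:
  fixes f :: "'a::euclidean_space \<Rightarrow> real"
  assumes S: "compact S" "convex S" "S \<noteq> {}" and f: "continuous_on UNIV f"
  obtains x where "x \<in> S" "\<And>y. y \<in> S \<Longrightarrow> f y - vex S f y \<le> f x - vex S f x"
proof -
  define H where "H = convex hull (graph_on S f)"
  have fS: "continuous_on S f"
    using f by (rule continuous_on_subset) simp
  note vex = vex_lower_boundary[OF S(1,2) fS, folded H_def]
  have "H \<noteq> {}"
    using S(3) vex(1) by blast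
  moreover have "continuous_on H (\<lambda>p. f (fst p) - snd p)"
    by (intro continuous_intros continuous_on_compose2[OF f]) auto
  ultimately obtain p where p: "p \<in> H" "\<And>q. q \<in> H \<Longrightarrow> f (fst q) - snd q \<le> f (fst p) - snd p"
    using continuous_attains_sup[of H "\<lambda>p. f (fst p) - snd p"] compact_convex_hull_graph[OF S(1) fS]
    unfolding H_def by blast
  \<comment> \<open>A constant convex underestimator, chosen only to conclude that the hull point
    \<open>p\<close> projects into \<open>S\<close>.\<close>
  have "convex_on S (\<lambda>_. Inf (f ` S))"
    using S(2) by (simp add: convex_on_const)
  moreover have "Inf (f ` S) \<le> f y" if "y \<in> S" for y
    using that S(1) fS by (intro cInf_lower bounded_imp_bdd_below compact_imp_bounded
        compact_continuous_image) auto
  ultimately have x: "fst p \<in> S"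
    using convex_hull_graph_above(1)[of S "\<lambda>_. Inf (f ` S)" f "fst p" "snd p"] p(1)
    by (simp add: H_def)
  \<comment> \<open>Lowering \<open>p\<close> to the envelope within its fibre cannot shrink the
    gap, so the maximum over the hull is reached on the envelope.\<close>
  have "f y - vex S f y \<le> f (fst p) - vex S f (fst p)" if "y \<in> S" for y
    using p(2)[OF vex(1)[OF that]] vex(2)[OF x, of "snd p"] p(1) by simp
  with x show thesis by (rule that)
qed

lemma vex_error_attained:
  assumes S: "compact S" "convex S" "S \<noteq> {}"
  obtains x where "x \<in> S"
    "monomial_error \<alpha> (graph_on S (vex S (monomial \<alpha>))) = monomial \<alpha> x - vex S (monomial \<alpha>) x"
proof -
  obtain x where x: "x \<in> S" "\<And>y. y \<in> S \<Longrightarrow>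
      monomial \<alpha> y - vex S (monomial \<alpha>) y \<le> monomial \<alpha> x - vex S (monomial \<alpha>) x"
    using vex_gap_attained[OF S continuous_on_monomial[of _ \<alpha>]] by metis
  have below: "vex S (monomial \<alpha>) y \<le> monomial \<alpha> y" if "y \<in> S" for y
    using that by (intro vex_lower_boundary(2) S continuous_on_monomial hull_inc)
      (auto simp: graph_on_def)
  have "monomial_error \<alpha> (graph_on S (vex S (monomial \<alpha>)))
      = \<bar>vex S (monomial \<alpha>) x - monomial \<alpha> x\<bar>"
  proof (rule monomial_error_eqI)
    fix y v assume "(y, v) \<in> graph_on S (vex S (monomial \<alpha>))"
    then have "y \<in> S" "v = vex S (monomial \<alpha>) y"
      by (auto simp: graph_on_def)
    with x(2)[of y] below[of y] below[OF x(1)]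
    show "\<bar>v - monomial \<alpha> y\<bar> \<le> \<bar>vex S (monomial \<alpha>) x - monomial \<alpha> x\<bar>"
      by simp
  qed (use x(1) in \<open>simp add: graph_on_def\<close>)
  with below[OF x(1)] show thesis
    by (intro that[OF x(1)]) simp
qed

text \<open>The last conclusion serves the sharpness argument, which evaluates the gap at one point
  of the diagonal.\<close>

lemma cav_error_attained:
  assumes S: "compact S" "convex S" "S \<noteq> {}"
  obtains x where "x \<in> S"
    "monomial_error \<alpha> (graph_on S (cav S (monomial \<alpha>))) = cav S (monomial \<alpha>) x - monomial \<alpha> x"
    "\<And>y. y \<in> S \<Longrightarrow> cav S (monomial \<alpha>) y - monomial \<alpha> y
      \<le> monomial_error \<alpha> (graph_on S (cav S (monomial \<alpha>)))"
proof -
  obtain x where x: "x \<in> S" and "\<And>y. y \<in> S \<Longrightarrow>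
      - monomial \<alpha> y - vex S (\<lambda>z. - monomial \<alpha> z) y \<le> - monomial \<alpha> x - vex S (\<lambda>z. - monomial \<alpha> z) x"
    using vex_gap_attained[OF S continuous_on_minus[OF continuous_on_monomial[of _ \<alpha>]]] by metis
  then have max: "cav S (monomial \<alpha>) y - monomial \<alpha> y \<le> cav S (monomial \<alpha>) x - monomial \<alpha> x"
    if "y \<in> S" for y
    using that by (fastforce simp: cav_eq_uminus_vex)
  have above: "monomial \<alpha> y \<le> cav S (monomial \<alpha>) y" if "y \<in> S" for y
    using that by (intro cav_upper_boundary(2) S continuous_on_monomial hull_inc)
      (auto simp: graph_on_def)
  have "monomial_error \<alpha> (graph_on S (cav S (monomial \<alpha>)))
      = \<bar>cav S (monomial \<alpha>) x - monomial \<alpha> x\<bar>"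
  proof (rule monomial_error_eqI)
    fix y v assume "(y, v) \<in> graph_on S (cav S (monomial \<alpha>))"
    then have "y \<in> S" "v = cav S (monomial \<alpha>) y"
      by (auto simp: graph_on_def)
    with max[of y] above[of y] above[OF x]
    show "\<bar>v - monomial \<alpha> y\<bar> \<le> \<bar>cav S (monomial \<alpha>) x - monomial \<alpha> x\<bar>"
      by simp
  qed (use x in \<open>simp add: graph_on_def\<close>)
  with above[OF x] max show thesis
    by (intro that[OF x]) simp_all
qed

subsection \<open>Bounds on the hull\<close>

text \<open>\<open>M\<close> is the largest \<open>j\<close>-th coordinate on \<open>S\<close>. The
  geometric sum is the secant slope of \<open>t ^ (\<alpha> $ j)\<close> between \<open>M\<close>
  and 1, and for \<open>M = 1\<close> the derivative at 1, which unifies both branches of the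
  definition.\<close>

lemma gamma_coord_eq_sum:
  assumes "compact S" "S \<noteq> {}" "S \<subseteq> cbox 0 1"
  obtains M where "0 \<le> M" "M \<le> 1" "\<And>x. x \<in> S \<Longrightarrow> x $ j \<le> M"
    "gamma_coord S \<alpha> j = (\<Sum>k<\<alpha> $ j. M ^ k)"
proof -
  have "continuous_on S (\<lambda>x. x $ j)"
    by (intro continuous_intros)
  from continuous_attains_sup[OF assms(1,2) this]
  obtain z where z: "z \<in> S" "\<And>x. x \<in> S \<Longrightarrow> x $ j \<le> z $ j"
    by blast
  have "maximum {x $ j | x. x \<in> S} = z $ j"
    by (rule maximum_eqI) (use z in auto)
  then have sigma: "sigma_coord S j = 1 - z $ j"
    by (simp add: sigma_coord_def)
  have z01: "0 \<le> z $ j" "z $ j \<le> 1"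
    using z(1) assms(3) by (auto simp: mem_box_cart)
  have "gamma_coord S \<alpha> j = (\<Sum>k<\<alpha> $ j. (z $ j) ^ k)"
  proof (cases "z $ j < 1")
    case True
    then show ?thesis
      using one_diff_power_eq[of "z $ j" "\<alpha> $ j"] by (simp add: gamma_coord_def sigma)
  next
    case False
    then have "z $ j = 1"
      using z01 by simp
    then show ?thesis
      by (simp add: gamma_coord_def sigma)
  qed
  with z z01 show thesis
    by (intro that[of "z $ j"])
qed

text \<open>All three follow termwise from the geometric sum: its first term is 1, no term exceeds
  1, and it grows with its base, where \<open>x $ j \<le> M\<close>.\<close>

lemma gamma_coord_bounds:
  assumes S: "compact S" "S \<noteq> {}" "S \<subseteq> cbox 0 1" and "\<alpha> $ j \<ge> 1"
  shows "1 \<le> gamma_coord S \<alpha> j" and "gamma_coord S \<alpha> j \<le> real (\<alpha> $ j)"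
    and "x \<in> S \<Longrightarrow> 1 - x $ j ^ (\<alpha> $ j) \<le> gamma_coord S \<alpha> j * (1 - x $ j)"
proof -
  obtain M where M: "0 \<le> M" "M \<le> 1" "\<And>x. x \<in> S \<Longrightarrow> x $ j \<le> M"
      and gamma: "gamma_coord S \<alpha> j = (\<Sum>k<\<alpha> $ j. M ^ k)"
    using gamma_coord_eq_sum[OF S] by blast
  have "(\<Sum>k<1. M ^ k) \<le> (\<Sum>k<\<alpha> $ j. M ^ k)"
    using assms(4) M by (intro sum_mono2) auto
  then show "1 \<le> gamma_coord S \<alpha> j"
    by (simp add: gamma)
  have "(\<Sum>k<\<alpha> $ j. M ^ k) \<le> (\<Sum>k<\<alpha> $ j. 1)"
    using M by (intro sum_mono power_le_one)
  then show "gamma_coord S \<alpha> j \<le> real (\<alpha> $ j)"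
    by (simp add: gamma)
  assume x: "x \<in> S"
  then have x01: "0 \<le> x $ j" "x $ j \<le> 1"
    using S(3) by (auto simp: mem_box_cart)
  have "1 - x $ j ^ (\<alpha> $ j) = (\<Sum>k<\<alpha> $ j. (x $ j) ^ k) * (1 - x $ j)"
    by (simp add: one_diff_power_eq mult.commute)
  also have "\<dots> \<le> gamma_coord S \<alpha> j * (1 - x $ j)"
    unfolding gamma using x01 M(3)[OF x] by (intro mult_right_mono sum_mono power_mono) auto
  finally show "1 - x $ j ^ (\<alpha> $ j) \<le> gamma_coord S \<alpha> j * (1 - x $ j)" .
qed

lemma gamma_sum_bounds:
  fixes S :: "(real ^ 'n) set"
  assumes "compact S" "S \<noteq> {}" "S \<subseteq> cbox 0 1" "\<And>j. \<alpha> $ j \<ge> 1"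
  shows "1 \<le> gamma_sum S \<alpha>" "gamma_sum S \<alpha> \<le> real (total_degree \<alpha>)"
proof -
  have "(\<Sum>j\<in>(UNIV :: 'n set). 1) \<le> gamma_sum S \<alpha>"
    unfolding gamma_sum_def using assms by (intro sum_mono gamma_coord_bounds)
  moreover have "1 \<le> real CARD('n)"
    by (simp add: Suc_leI)
  ultimately show "1 \<le> gamma_sum S \<alpha>"
    by (simp only: sum_constant mult_1_right)
  show "gamma_sum S \<alpha> \<le> real (total_degree \<alpha>)"
    unfolding gamma_sum_def total_degree_def of_nat_sum
    using assms by (intro sum_mono gamma_coord_bounds)
qed

text \<open>On the unit interval smaller exponents give larger powers; then weighted AM-GM applies
  with weights \<open>g\<close>.\<close>

lemma monomial_le_powr:
  assumes x: "\<And>j. 0 \<le> x $ j \<and> x $ j \<le> 1" and g: "\<And>j. 0 \<le> g j \<and> g j \<le> real (\<alpha> $ j)"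
    and \<alpha>: "\<And>j. \<alpha> $ j \<ge> 1" and pos: "sum g UNIV > 0"
  shows "monomial \<alpha> x \<le> ((\<Sum>j\<in>UNIV. g j * x $ j) / sum g UNIV) powr sum g UNIV"
proof -
  have "x $ j ^ (\<alpha> $ j) \<le> x $ j powr g j" for j
  proof (cases "x $ j = 0")
    case True
    then show ?thesis
      using \<alpha>[of j] by (simp add: power_0_left)
  next
    case False
    then have "x $ j ^ (\<alpha> $ j) = x $ j powr real (\<alpha> $ j)"
      using x[of j] by (simp add: powr_realpow less_le)
    also have "\<dots> \<le> x $ j powr g j"
      using x[of j] g[of j] by (intro powr_mono') auto
    finally show ?thesis .
  qed
  then have "monomial \<alpha> x \<le> (\<Prod>j\<in>UNIV. x $ j powr g j)"
    unfolding monomial_def using x by (intro prod_mono) auto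
  also have "\<dots> \<le> ((\<Sum>j\<in>UNIV. g j * x $ j) / sum g UNIV) powr sum g UNIV"
    using x g pos by (intro weighted_arith_geom_mean) auto
  finally show ?thesis .
qed

lemma hull_gap_below:
  fixes S :: "(real ^ 'n) set"
  assumes \<alpha>: "\<And>j. \<alpha> $ j \<ge> 1" and S: "compact S" "S \<noteq> {}" "S \<subseteq> cbox 0 1" "convex S"
    and H: "(x, w) \<in> convex hull (graph_on S (monomial \<alpha>))"
  shows "monomial \<alpha> x - w \<le> (1 - 1 / gamma_sum S \<alpha>) powr gamma_sum S \<alpha>"
proof -
  define \<Gamma> where "\<Gamma> = gamma_sum S \<alpha>"
  define L where "L = (\<lambda>z. 1 - (\<Sum>j\<in>UNIV. gamma_coord S \<alpha> j * (1 - z $ j)))"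
  have \<Gamma>: "1 \<le> \<Gamma>"
    unfolding \<Gamma>_def using assms by (intro gamma_sum_bounds)
  have unit: "0 \<le> z $ j \<and> z $ j \<le> 1" if "z \<in> S" for z j
    using that S(3) by (auto simp: mem_box_cart)
  have zero: "0 \<le> monomial \<alpha> z" if "z \<in> S" for z
    unfolding monomial_def using unit[OF that] by (intro prod_nonneg) simp
  have convex0: "convex_on S (\<lambda>_. 0 :: real)"
    using S(4) by (simp add: convex_on_const)
  note xS = convex_hull_graph_above(1)[OF convex0 zero H]
  have w0: "0 \<le> w"
    by (rule convex_hull_graph_above(2)[OF convex0 zero H])
  \<comment> \<open>\<open>L\<close> is affine: a linear part \<open>A\<close> plus the constant
    \<open>1 - \<Gamma>\<close>, which splits because \<open>s + t = 1\<close>.\<close>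
  have "L (s *\<^sub>R y + t *\<^sub>R z) = s * L y + t * L z" if "s + t = 1" for s t y z
  proof -
    define A where "A = (\<lambda>z. \<Sum>j\<in>UNIV. gamma_coord S \<alpha> j * z $ j)"
    have L: "L z = (1 - \<Gamma>) + A z" for z
      by (simp add: L_def A_def \<Gamma>_def gamma_sum_def right_diff_distrib sum_subtractf)
    have "A (s *\<^sub>R y + t *\<^sub>R z) = s * A y + t * A z"
      by (simp add: A_def sum.distrib sum_distrib_left algebra_simps)
    moreover have "1 - \<Gamma> = s * (1 - \<Gamma>) + t * (1 - \<Gamma>)"
      using that by (simp flip: distrib_right)
    ultimately show ?thesis
      unfolding L by (simp add: distrib_left)
  qed
  then have "convex_on S L"
    using S(4) by (auto simp: convex_on_def)
  moreover have "L z \<le> monomial \<alpha> z" if "z \<in> S" for z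
  proof -
    have "(\<Sum>j\<in>UNIV. 1 - z $ j ^ (\<alpha> $ j)) \<le> (\<Sum>j\<in>UNIV. gamma_coord S \<alpha> j * (1 - z $ j))"
      using assms that by (intro sum_mono gamma_coord_bounds)
    moreover have "1 - (\<Sum>j\<in>UNIV. 1 - z $ j ^ (\<alpha> $ j)) \<le> monomial \<alpha> z"
      unfolding monomial_def using unit[OF that] by (intro one_minus_sum_le_prod) (auto intro: power_le_one)
    ultimately show ?thesis
      by (simp add: L_def)
  qed
  ultimately have wL: "L x \<le> w"
    using H by (rule convex_hull_graph_above(2))
  \<comment> \<open>\<open>y\<close> is the weighted mean of the \<open>1 - x $ j\<close>. Both the
    lower bound \<open>L x\<close> for \<open>w\<close> and the AM-GM bound for the monomial depend
    on \<open>x\<close> only through \<open>y\<close>.\<close>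
  define y where "y = (\<Sum>j\<in>UNIV. gamma_coord S \<alpha> j * (1 - x $ j)) / \<Gamma>"
  have gpos: "0 \<le> gamma_coord S \<alpha> j \<and> gamma_coord S \<alpha> j \<le> real (\<alpha> $ j)" for j
    using gamma_coord_bounds(1,2)[OF S(1-3) \<alpha>, of j] by auto
  have "(\<Sum>j\<in>UNIV. gamma_coord S \<alpha> j * x $ j) = \<Gamma> - (\<Sum>j\<in>UNIV. gamma_coord S \<alpha> j * (1 - x $ j))"
    by (simp add: \<Gamma>_def gamma_sum_def right_diff_distrib sum_subtractf)
  then have mean: "(\<Sum>j\<in>UNIV. gamma_coord S \<alpha> j * x $ j) / \<Gamma> = 1 - y"
    using \<Gamma> by (simp add: y_def diff_divide_distrib)
  have "0 \<le> y"
    unfolding y_def using \<Gamma> gpos unit[OF xS] by (intro divide_nonneg_nonneg sum_nonneg mult_nonneg_nonneg) auto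
  moreover have "0 \<le> 1 - y"
    unfolding mean[symmetric] using \<Gamma> gpos unit[OF xS]
    by (intro divide_nonneg_nonneg sum_nonneg mult_nonneg_nonneg) auto
  ultimately have "(1 - y) powr \<Gamma> - max 0 (1 - \<Gamma> * y) \<le> (1 - 1 / \<Gamma>) powr \<Gamma>"
    using \<Gamma> by (intro powr_minus_max_affine_le) auto
  moreover have "1 - \<Gamma> * y = L x"
    using \<Gamma> by (simp add: y_def L_def)
  moreover have "monomial \<alpha> x \<le> (1 - y) powr \<Gamma>"
    using monomial_le_powr[of x "gamma_coord S \<alpha>" \<alpha>, OF unit[OF xS] gpos \<alpha>] mean \<Gamma>
    by (simp add: \<Gamma>_def gamma_sum_def)
  ultimately show ?thesis
    using w0 wL by (simp add: \<Gamma>_def)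
qed

lemma hull_gap_above:
  fixes S :: "(real ^ 'n) set"
  assumes \<alpha>: "\<And>j. \<alpha> $ j \<ge> 1" "total_degree \<alpha> \<ge> 2" and S: "S \<subseteq> cbox 0 1" "convex S"
    and H: "(x, w) \<in> convex hull (graph_on S (monomial \<alpha>))"
  shows "w - monomial \<alpha> x \<le> C1 (total_degree \<alpha>)"
proof -
  have unit: "0 \<le> z $ j \<and> z $ j \<le> 1" if "z \<in> S" for z j
    using that S(1) by (auto simp: mem_box_cart)
  have "0 \<le> monomial \<alpha> z" if "z \<in> S" for z
    unfolding monomial_def using unit[OF that] by (intro prod_nonneg) simp
  then have "x \<in> S"
    using convex_hull_graph_above(1)[of S "\<lambda>_. 0" "monomial \<alpha>" x w] S(2) H
    by (simp add: convex_on_const)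
  obtain k where k: "\<And>j. x $ k \<le> x $ j"
    using ex_min_if_finite[of "range (\<lambda>j. x $ j)"] by (auto simp: not_less)
  \<comment> \<open>The index \<open>k\<close> was chosen for \<open>x\<close>, but the projection
    to it overestimates the monomial on all of \<open>S\<close>.\<close>
  have "concave_on S (\<lambda>z. z $ k)"
    using S(2) by (auto simp: concave_on_iff)
  moreover have "monomial \<alpha> z \<le> z $ k" if "z \<in> S" for z
  proof -
    have "monomial \<alpha> z = z $ k ^ (\<alpha> $ k) * (\<Prod>j\<in>UNIV - {k}. z $ j ^ (\<alpha> $ j))"
      unfolding monomial_def by (rule prod.remove) auto
    also have "\<dots> \<le> z $ k ^ 1 * 1"
      using unit[OF that] \<alpha>(1)[of k]
      by (intro mult_mono power_decreasing prod_le_1 conjI zero_le_power power_le_one prod_nonneg ballI) auto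
    finally show ?thesis by simp
  qed
  ultimately have "w \<le> x $ k"
    using H by (rule convex_hull_graph_below)
  moreover have "(x $ k) ^ total_degree \<alpha> \<le> monomial \<alpha> x"
    unfolding total_degree_def power_sum monomial_def
    using unit[OF \<open>x \<in> S\<close>] k by (intro prod_mono) (auto intro: power_mono)
  moreover have "x $ k - (x $ k) ^ total_degree \<alpha> \<le> C1 (total_degree \<alpha>)"
    using unit[OF \<open>x \<in> S\<close>] \<alpha>(2) by (intro minus_power_le_C1) auto
  ultimately show ?thesis by linarith
qed

lemma diagonal_in_hull:
  assumes "\<And>j. \<alpha> $ j \<ge> 1" "0 \<in> S" "1 \<in> S" "0 \<le> t" "t \<le> 1"
  shows "(t *\<^sub>R 1, t) \<in> convex hull (graph_on S (monomial \<alpha>))"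
proof -
  have "monomial \<alpha> 0 = 0"
    \<comment> \<open>\<open>undefined\<close> stands for an arbitrary index; its exponent is
      positive, so that factor vanishes at the origin.\<close>
    using assms(1)[of undefined] by (auto simp: monomial_def power_0_left intro!: exI[of _ undefined])
  then have "(0, 0) \<in> graph_on S (monomial \<alpha>)" "(1, 1) \<in> graph_on S (monomial \<alpha>)"
    using assms by (auto simp: graph_on_def monomial_def)
  then have "(1 - t) *\<^sub>R (0, 0) + t *\<^sub>R (1, 1) \<in> convex hull (graph_on S (monomial \<alpha>))"
    using assms by (intro convexD[OF convex_convex_hull] hull_inc) auto
  then show ?thesis by simp
qed


section \<open>Assembly of the bounds, and sharpness on the diagonal\<close>

theorem theorem1p1:
  fixes S :: "(real ^ 'n) set" and \<alpha> :: "nat ^ 'n"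
  assumes "\<And>j. \<alpha> $ j \<ge> 1"
    and "total_degree \<alpha> \<ge> 2"
    and "S \<subseteq> cbox 0 1" and "S \<noteq> {}" and "compact S" and "convex S"
  shows
    "monomial_error \<alpha> (graph_on S (vex S (monomial \<alpha>)))
       \<le> (1 - 1 / gamma_sum S \<alpha>) powr gamma_sum S \<alpha> \<and>
     (1 - 1 / gamma_sum S \<alpha>) powr gamma_sum S \<alpha> \<le> C2 (total_degree \<alpha>) \<and>
     monomial_error \<alpha> (graph_on S (cav S (monomial \<alpha>)))
       \<le> monomial_error \<alpha> (convex hull (graph_on S (monomial \<alpha>))) \<and>
     monomial_error \<alpha> (convex hull (graph_on S (monomial \<alpha>))) \<le> C1 (total_degree \<alpha>) \<and>
     (0 \<in> S \<and> 1 \<in> S \<longrightarrow>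
       monomial_error \<alpha> (convex hull (graph_on S (monomial \<alpha>)))
         = monomial_error \<alpha> (graph_on S (cav S (monomial \<alpha>))) \<and>
       monomial_error \<alpha> (graph_on S (cav S (monomial \<alpha>))) = C1 (total_degree \<alpha>))"
proof -
  define f where "f = monomial \<alpha>"
  define d where "d = total_degree \<alpha>"
  define \<Gamma> where "\<Gamma> = gamma_sum S \<alpha>"
  define H where "H = convex hull (graph_on S f)"
  note S = \<open>compact S\<close> \<open>convex S\<close> \<open>S \<noteq> {}\<close>
  have f: "continuous_on S f"
    unfolding f_def by (rule continuous_on_monomial)
  note below = hull_gap_below[OF assms(1) assms(5,4,3,6), folded f_def \<Gamma>_def, folded H_def]
  note above = hull_gap_above[OF assms(1,2,3,6), folded f_def d_def, folded H_def]
  note vexH = vex_lower_boundary(1)[OF S(1,2) f, folded H_def]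
  note cavH = cav_upper_boundary[OF S(1,2) f, folded H_def]
  have "H \<noteq> {}"
    using S(3) vexH by blast
  then obtain x w where xw: "(x, w) \<in> H" "monomial_error \<alpha> H = \<bar>w - f x\<bar>"
      and hull_max: "\<And>y v. (y, v) \<in> H \<Longrightarrow> \<bar>v - f y\<bar> \<le> monomial_error \<alpha> H"
    using monomial_error_attained[of H \<alpha>] compact_convex_hull_graph[OF S(1) f]
    unfolding f_def H_def by metis
  obtain p where p: "p \<in> S" "monomial_error \<alpha> (graph_on S (vex S f)) = f p - vex S f p"
    using vex_error_attained[OF S] unfolding f_def by metis
  obtain q where q: "q \<in> S" "monomial_error \<alpha> (graph_on S (cav S f)) = cav S f q - f q"
      and cav_max: "\<And>y. y \<in> S \<Longrightarrow> cav S f y - f y \<le> monomial_error \<alpha> (graph_on S (cav S f))"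
    using cav_error_attained[OF S] unfolding f_def by metis
  have gamma: "1 \<le> \<Gamma>" "\<Gamma> \<le> real d"
    using gamma_sum_bounds[OF assms(5,4,3,1)] by (simp_all add: \<Gamma>_def d_def)
  have "(1 - 1 / \<Gamma>) powr \<Gamma> \<le> (1 - 1 / real d) powr real d"
    using gamma by (rule one_minus_inverse_powr_mono)
  also have "\<dots> = C2 d"
    using assms(2) by (simp add: C2_def d_def powr_realpow)
  finally have C2: "(1 - 1 / \<Gamma>) powr \<Gamma> \<le> C2 d" .
  have C1: "C2 d \<le> C1 d"
    using assms(2) by (simp add: d_def C2_le_C1)
  have vex_bound: "monomial_error \<alpha> (graph_on S (vex S f)) \<le> (1 - 1 / \<Gamma>) powr \<Gamma>"
    unfolding p(2) using vexH[OF p(1)] by (rule below)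
  have cav_bound: "monomial_error \<alpha> (graph_on S (cav S f)) \<le> monomial_error \<alpha> H"
    unfolding q(2) using hull_max[OF cavH(1)[OF q(1)]] by simp
  \<comment> \<open>Both signs of \<open>w - f x\<close> occur: the gap below is at most
    \<open>C2 d \<le> C1 d\<close>, the gap above at most \<open>C1 d\<close>.\<close>
  have hull_bound: "monomial_error \<alpha> H \<le> C1 d"
    unfolding xw(2) using below[OF xw(1)] above[OF xw(1)] C1 C2 by linarith
  \<comment> \<open>This closes the chain formed by \<open>cav_bound\<close> and
    \<open>hull_bound\<close>, forcing equality throughout.\<close>
  have "C1 d \<le> monomial_error \<alpha> (graph_on S (cav S f))" if "0 \<in> S" "1 \<in> S"
  proof -
    define c where "c = real d powr (1 / (1 - real d))"
    note c = C1_argmax[OF assms(2), folded d_def, folded c_def]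
    have cH: "(c *\<^sub>R 1, c) \<in> H"
      unfolding H_def f_def using assms(1) that c by (intro diagonal_in_hull) auto
    have cS: "c *\<^sub>R 1 \<in> S"
      using convexD[OF S(2) that, of "1 - c" c] c by simp
    have "f (c *\<^sub>R 1) = c ^ d"
      by (simp add: f_def monomial_def d_def total_degree_def power_sum)
    with cavH(2)[OF cS cH] cav_max[OF cS] c(4) show ?thesis
      by simp
  qed
  with vex_bound C2 cav_bound hull_bound show ?thesis
    unfolding f_def d_def \<Gamma>_def H_def by force
qed

end
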